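(* Let $c>0$, let $n\ge k\ge 0$ be integers, and let $G$ be any graph in $\mathcal{C}_n^k$. Then $$\prod\nolimits_{1,c}(G)\;\ge\;\begin{cases}3^{kc}\,2^{(n-2k)c} & \text{if } k=0,1,\\[2pt] 2^{(n-k-1)c}\,k^{c} & \text{if } k\ge 2.\end{cases}$$ For $k=0,1$, equality holds if and only if the degree sequence of $G$ is $\underbrace{3,3,\dots,3}_{k},\underbrace{2,2,\dots,2}_{n-2k},\underbrace{1,1,\dots,1}_{k}$. For $k\ge 2$, equality holds if and only if the degree sequence of $G$ is $k,\underbrace{2,2,\dots,2}_{n-k-1},\underbrace{1,1,\dots,1}_{k}$.
   Context: Graphs are simple and connected. A cactus is a connected graph all of whose blocks are either edges or cycles, i.e. any two of its cycles have at most one common vertex (trees are included). A pendant vertex is a vertex of degree $1$. For $n\ge k\ge 0$, $\mathcal{C}_n^k$ denotes the set of cactus graphs with $n$ vertices including $k$ pendant vertices. For $c>0$ the first (generalized) multiplicative Zagreb index is $\prod_{1,c}(G)=\prod_{v\in V(G)}d(v)^c$, where $d(v)$ is the degree of $v$. *)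

theory Defs
  imports Complex_Main "HOL-Library.Multiset" "Graph_Theory.Graph_Theory"
begin

text \<open>
  Finite simple graphs are the locale \<^locale>\<open>Digraph.graph\<close> of Graph_Theory, which represents
  an undirected edge by two opposite arcs. Hence the degree of a vertex is its
  \<^const>\<open>out_degree\<close>, and the strongly connected components \<^const>\<open>pre_digraph.sccs\<close> are the
  connected components. Note that \<^const>\<open>Digraph_Component.connected\<close> excludes the null graph.
\<close>

definition cut_vertex :: "('a, 'b) pre_digraph \<Rightarrow> 'a \<Rightarrow> bool" where
  "cut_vertex G v \<longleftrightarrow> v \<in> verts G \<and>
     card (pre_digraph.sccs (pre_digraph.del_vert G v)) > card (pre_digraph.sccs G)"

text \<open>
  The requirement \<^term>\<open>Digraph.graph H\<close> restricts the sub-digraphs to those that contain an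
  arc together with its reverse. The only block of the one-vertex graph is the graph itself.
\<close>

definition block :: "('a, 'b) pre_digraph \<Rightarrow> ('a, 'b) pre_digraph \<Rightarrow> bool" where
  "block G = pre_digraph.max_subgraph G
     (\<lambda>H. Digraph.graph H \<and> Digraph_Component.connected H \<and> (\<forall>v. \<not> cut_vertex H v))"

definition cycle_graph :: "('a, 'b) pre_digraph \<Rightarrow> bool" where
  "cycle_graph H \<longleftrightarrow> Digraph.graph H \<and>
     (\<exists>vs. distinct vs \<and> length vs \<ge> 3 \<and> verts H = set vs \<and>
        arcs_ends H = (\<Union>i<length vs. {(vs ! i, vs ! (Suc i mod length vs)),
                                       (vs ! (Suc i mod length vs), vs ! i)}))"

text \<open>
  The one-vertex graph is not a cactus, as its block is neither an edge nor a cycle.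
\<close>

definition cactus :: "('a, 'b) pre_digraph \<Rightarrow> bool" where
  "cactus G \<longleftrightarrow> Digraph.graph G \<and> Digraph_Component.connected G \<and>
     (\<forall>B. block G B \<longrightarrow> complete_digraph 2 B \<or> cycle_graph B)"

definition pendant_verts :: "('a, 'b) pre_digraph \<Rightarrow> 'a set" where
  "pendant_verts G = {v \<in> verts G. out_degree G v = 1}"

definition cacti :: "nat \<Rightarrow> nat \<Rightarrow> ('a, 'b) pre_digraph set" where
  "cacti n k = {G. cactus G \<and> card (verts G) = n \<and> card (pendant_verts G) = k}"

definition mult_Zagreb1 :: "real \<Rightarrow> ('a, 'b) pre_digraph \<Rightarrow> real" where
  "mult_Zagreb1 c G = (\<Prod>v\<in>verts G. real (out_degree G v) powr c)"

definition degree_mset :: "('a, 'b) pre_digraph \<Rightarrow> nat multiset" where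
  "degree_mset G = image_mset (out_degree G) (mset_set (verts G))"

text \<open>
  A degree sequence is written as a list of pairs \<open>(d, m)\<close>, standing for \<open>m\<close> terms equal to
  \<open>d\<close>. The multiplicities are integers: in the sequence \<open>k, 2, \<dots>, 2, 1, \<dots>, 1\<close> with
  \<open>n - k - 1\<close> twos and \<open>k\<close> ones, the single edge (\<open>n = k = 2\<close>) gives \<open>-1\<close> twos, which cancel
  the leading \<open>k = 2\<close>. For nonnegative multiplicities this is equality of multisets.
\<close>

definition has_degree_sequence :: "('a, 'b) pre_digraph \<Rightarrow> (nat \<times> int) list \<Rightarrow> bool" where
  "has_degree_sequence G ps \<longleftrightarrow>
     (\<forall>d. int (count (degree_mset G) d) = (\<Sum>(e, m)\<leftarrow>ps. if e = d then m else 0))"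

lemma has_degree_sequence_nonneg:
  "has_degree_sequence G (map (\<lambda>(e, m). (e, int m)) ps) \<longleftrightarrow>
     degree_mset G = (\<Sum>(e, m)\<leftarrow>ps. replicate_mset m e)"
proof -
  have "(\<Sum>(e, m)\<leftarrow>map (\<lambda>(e, m). (e, int m)) ps. if e = d then m else 0)
      = int (count (\<Sum>(e, m)\<leftarrow>ps. replicate_mset m e) d)" for d
    by (induction ps) auto
  then show ?thesis
    by (simp add: has_degree_sequence_def multiset_eq_iff)
qed

end

theory Submission
  imports Defs
begin

text \<open>
  Let \<open>s\<close> be the sum of
  \<open>d(v) - 2\<close> over the non-pendant vertices, all of which have degree at least \<open>2\<close>. The
  product of the \<open>1 + (d(v) - 2) / 2\<close> is at least \<open>1 + s / 2\<close>, with equality iff at most one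
  of these vertices has degree other than \<open>2\<close>. A connected graph has at least \<open>n - 1\<close>
  edges, which gives \<open>s \<ge> k - 2\<close>; for \<open>k = 1\<close> the number \<open>s\<close> is odd by the handshaking
  lemma, so \<open>s \<ge> 1\<close>.
\<close>

section \<open>Handshaking and parity of the arc count\<close>

text \<open>A pair and its reverse are distinct and both present, so elements can be removed two at
  a time; what remains is again symmetric and irreflexive.\<close>

lemma even_card_sym_irrefl:
  assumes "finite E" "sym E" "irrefl E"
  shows "even (card E)"
  using assms
proof (induction E rule: finite_psubset_induct)
  case (psubset E)
  show ?case
  proof (cases "E = {}")
    case False
    then obtain u v where uv: "(u, v) \<in> E"
      by auto
    then have vu: "(v, u) \<in> E" and "u \<noteq> v"
      using psubset.prems by (auto dest: symD simp: irrefl_def)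
    let ?F = "E - {(u, v), (v, u)}"
    have "even (card ?F)"
      using psubset.prems uv by (intro psubset.IH) (auto simp: sym_def irrefl_def)
    moreover have "card E = card ?F + 2"
      using psubset.hyps uv vu \<open>u \<noteq> v\<close> card_Diff_subset[of "{(u, v), (v, u)}" E]
        card_mono[of E "{(u, v), (v, u)}"]
      by simp
    ultimately show ?thesis
      by simp
  qed simp
qed

lemma (in fin_digraph) sum_out_degree: "(\<Sum>v\<in>verts G. out_degree G v) = card (arcs G)"
proof -
  have "card (\<Union>v\<in>verts G. out_arcs G v) = (\<Sum>v\<in>verts G. card (out_arcs G v))"
    by (intro card_UN_disjoint) auto
  moreover have "(\<Union>v\<in>verts G. out_arcs G v) = arcs G"
    by auto
  ultimately show ?thesis
    by (simp add: out_degree_def)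
qed

lemma (in graph) card_arcs_ends: "card (arcs_ends G) = card (arcs G)"
  unfolding arcs_ends_def by (rule card_image[OF inj_on_arc_to_ends])

text \<open>Each edge is a pair of opposite arcs. The parity sharpens the degree bound when there is
  exactly one pendant vertex.\<close>

lemma (in graph) even_card_arcs: "even (card (arcs G))"
proof -
  have "even (card (arcs_ends G))"
  proof (rule even_card_sym_irrefl)
    show "finite (arcs_ends G)"
      by (simp add: arcs_ends_def)
    show "sym (arcs_ends G)"
      using sym_arcs by (simp add: symmetric_def)
    show "irrefl (arcs_ends G)"
      using adj_not_same by (auto simp: irrefl_def)
  qed
  then show ?thesis
    by (simp add: card_arcs_ends)
qed

section \<open>Connectedness: edge count and positive degrees\<close>

lemma (in wf_digraph) strongly_connected_leaves:
  assumes "strongly_connected G" "S \<subset> verts G" "S \<noteq> {}"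
  obtains u v where "u \<in> S" "v \<in> verts G - S" "(u, v) \<in> arcs_ends G"
proof -
  obtain r w where r: "r \<in> S" and w: "w \<in> verts G" "w \<notin> S"
    using assms(2,3) by auto
  then have "r \<rightarrow>\<^sup>*\<^bsub>G\<^esub> w"
    using assms(1,2) by (auto simp: strongly_connected_def)
  \<comment> \<open>The implication makes the induction cover endpoints inside \<open>S\<close> too:
    a step from \<open>x\<close> to \<open>y\<close> with \<open>y\<close> outside \<open>S\<close>
    either has \<open>x\<close> outside as well, or is itself the arc leaving
    \<open>S\<close>.\<close>
  then have "w \<notin> S \<Longrightarrow> \<exists>u\<in>S. \<exists>v\<in>verts G - S. (u, v) \<in> arcs_ends G"
  proof (induction rule: reachable_induct)
    case base
    then show ?case
      using r by simp
  next
    case (step x y)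
    then show ?case
      using adj_in_verts[of x y] by blast
  qed
  then show ?thesis
    using w that by blast
qed

text \<open>A set spanning a connected subgraph is grown one vertex, and hence one edge, at a time.\<close>

lemma (in graph) connected_card_arcs:
  assumes "connected G"
  shows "2 * card (verts G) \<le> card (arcs G) + 2"
proof -
  have sc: "strongly_connected G"
    using symmetric_connected_imp_strongly_connected[OF sym_arcs assms] .
  then obtain r where r: "r \<in> verts G"
    by (auto simp: strongly_connected_def)
  have fin: "finite (arcs_ends G)"
    by (simp add: arcs_ends_def)
  \<comment> \<open>The factor 2 counts each edge once per direction; the claim is the case
    \<open>m = card (verts G) - 1\<close>.\<close>
  have "\<exists>S\<subseteq>verts G. card S = Suc m \<and> 2 * m \<le> card (arcs_ends G \<inter> S \<times> S)"
    if "Suc m \<le> card (verts G)" for m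
    using that
  proof (induction m)
    case 0
    then show ?case
      using r by (intro exI[of _ "{r}"]) simp
  next
    case (Suc m)
    then obtain S where S: "S \<subseteq> verts G" "card S = Suc m"
      and arcs: "2 * m \<le> card (arcs_ends G \<inter> S \<times> S)"
      by auto
    have "finite S"
      using finite_subset[OF S(1)] by simp
    have "S \<subset> verts G" "S \<noteq> {}"
      using S Suc.prems by auto
    then obtain u v where uv: "u \<in> S" "v \<in> verts G - S" "(u, v) \<in> arcs_ends G"
      using strongly_connected_leaves[OF sc] by metis
    then have "(v, u) \<in> arcs_ends G" "u \<noteq> v"
      using graph_symmetric by auto
    \<comment> \<open>Both directions of the crossing edge are new, since \<open>v\<close> lies
      outside \<open>S\<close>, so the count grows by two.\<close>
    then have "card ({(u, v), (v, u)} \<union> (arcs_ends G \<inter> S \<times> S))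
        \<le> card (arcs_ends G \<inter> insert v S \<times> insert v S)"
      using uv fin by (intro card_mono) auto
    moreover have "card ({(u, v), (v, u)} \<union> (arcs_ends G \<inter> S \<times> S))
        = 2 + card (arcs_ends G \<inter> S \<times> S)"
      using uv fin \<open>u \<noteq> v\<close> by (subst card_Un_disjoint) auto
    ultimately show ?case
      using arcs S uv \<open>finite S\<close> by (intro exI[of _ "insert v S"]) auto
  qed
  from this[of "card (verts G) - 1"] obtain S where "S \<subseteq> verts G" "card S = card (verts G)"
    and le: "2 * (card (verts G) - 1) \<le> card (arcs_ends G \<inter> S \<times> S)"
    using r by (metis One_nat_def Suc_pred card_gt_0_iff empty_iff finite_verts le_refl)
  have "card (arcs_ends G \<inter> S \<times> S) \<le> card (arcs G)"
    using fin by (metis card_arcs_ends card_mono inf_le1)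
  then show ?thesis
    using le by linarith
qed

text \<open>Some arc leaves the proper subset \<open>{v}\<close>. With the exclusion of one-vertex
  cacti below, this makes all degrees positive.\<close>

lemma (in wf_digraph) strongly_connected_out_arcs:
  assumes "strongly_connected G" "v \<in> verts G" "verts G \<noteq> {v}"
  shows "out_arcs G v \<noteq> {}"
proof -
  have "{v} \<subset> verts G"
    using assms by auto
  then obtain u w where "u \<in> {v}" "(u, w) \<in> arcs_ends G"
    using strongly_connected_leaves[OF assms(1) _ insert_not_empty] by metis
  then show ?thesis
    by (auto elim!: reachableE)
qed

text \<open>Such a graph has no arcs and no cut vertex, so it is a block of itself; but an edge has
  two vertices and a cycle at least three.\<close>

lemma cactus_not_single_vertex:
  assumes "cactus G"
  shows "verts G \<noteq> {v}"
proof
  assume v: "verts G = {v}"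
  interpret graph G
    using assms by (simp add: cactus_def)
  have arcs: "arcs G = {}"
    using no_loops tail_in_verts head_in_verts v by (metis equals0I singletonD)
  \<comment> \<open>Mutual inclusion gives equal arcs, and compatibility gives equal
    \<open>tail\<close> and \<open>head\<close>, so the records coincide.\<close>
  have "H = G" if "verts H = verts G" "subgraph G H" "subgraph H G" for H :: "('a, 'b) pre_digraph"
    using that by (intro pre_digraph.equality) (auto simp: subgraph_def compatible_def)
  then have max: "H = G" if "subgraph G H" "subgraph H G" for H
    using that by (meson subgraph_def subset_antisym)
  \<comment> \<open>Deleting the only vertex leaves no components, whereas a cut vertex needs their
    number to grow.\<close>
  have "\<not> cut_vertex G u" for u
  proof
    assume "cut_vertex G u"
    then have u: "u = v" and "pre_digraph.sccs (pre_digraph.del_vert G u) \<noteq> {}"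
      using v by (auto simp: cut_vertex_def)
    then obtain H where "H \<in> pre_digraph.sccs (pre_digraph.del_vert G v)"
      by auto
    then show False
      using v by (auto simp: pre_digraph.sccs_def induced_subgraph_def subgraph_def
          strongly_connected_def pre_digraph.del_vert_def)
  qed
  then have "block G G"
    using assms max graph_axioms subgraph_refl
    by (auto simp: block_def cactus_def intro!: max_subgraphI)
  then have "complete_digraph 2 G \<or> cycle_graph G"
    using assms by (simp add: cactus_def)
  then show False
  proof
    assume "cycle_graph G"
    then obtain vs where "distinct vs" "length vs \<ge> 3" "verts G = set vs"
      by (auto simp: cycle_graph_def)
    then have "card {v} = length vs"
      using v distinct_card by metis
    then show False
      using \<open>length vs \<ge> 3\<close> by simp
  qed (use v in \<open>simp add: complete_digraph_def\<close>)
qed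

section \<open>The product inequality and its equality case\<close>

text \<open>Denominator-free form of bounding the product of the \<open>1 + y / 2\<close> below by 1
  plus half the sum, where \<open>y\<close> stands for a degree minus 2. The empty multiset is
  listed apart because it has no entry to carry the sum.\<close>

lemma prod_mset_add_two:
  fixes Y :: "nat multiset"
  shows "2 ^ size Y * (sum_mset Y + 2) \<le> 2 * (\<Prod>y\<in>#Y. y + 2) \<and>
    (2 ^ size Y * (sum_mset Y + 2) = 2 * (\<Prod>y\<in>#Y. y + 2) \<longleftrightarrow>
      Y = {#} \<or> Y = add_mset (sum_mset Y) (replicate_mset (size Y - 1) 0))"
proof (induction Y)
  case (add y Y)
  define a s P where "a = (2::nat) ^ size Y" and "s = sum_mset Y" and "P = (\<Prod>y\<in>#Y. y + 2)"
  have a: "a > 0"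
    by (simp add: a_def)
  have IH: "a * (s + 2) \<le> 2 * P"
    "a * (s + 2) = 2 * P \<longleftrightarrow> Y = {#} \<or> Y = add_mset s (replicate_mset (size Y - 1) 0)"
    using add.IH by (auto simp: a_def s_def P_def)
  \<comment> \<open>Inserting \<open>y\<close> loses exactly the cross term
    \<open>a * s * y\<close>, so equality requires equality for \<open>Y\<close> and one of
    \<open>s\<close>, \<open>y\<close> to vanish.\<close>
  have expand: "2 * a * (y + s + 2) + a * s * y = a * (s + 2) * (y + 2)"
    by (simp add: algebra_simps)
  have le: "a * (s + 2) * (y + 2) \<le> 2 * P * (y + 2)"
    using IH(1) by (rule mult_right_mono) simp
  have "2 * a * (y + s + 2) = 2 * P * (y + 2) \<longleftrightarrow> a * (s + 2) * (y + 2) = 2 * P * (y + 2) \<and> a * s * y = 0"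
    using expand le by linarith
  also have "\<dots> \<longleftrightarrow> a * (s + 2) = 2 * P \<and> (s = 0 \<or> y = 0)"
  proof -
    have "a * (s + 2) * (y + 2) = 2 * P * (y + 2) \<longleftrightarrow> a * (s + 2) = 2 * P"
      by (simp only: mult_cancel2) simp
    then show ?thesis
      using a by simp
  qed
  also have "\<dots> \<longleftrightarrow> add_mset y Y = add_mset (y + s) (replicate_mset (size Y) 0)"
  proof
    assume asm: "a * (s + 2) = 2 * P \<and> (s = 0 \<or> y = 0)"
    consider "Y = {#}" | "Y \<noteq> {#}" "Y = add_mset s (replicate_mset (size Y - 1) 0)"
      using asm IH(2) by auto
    then show "add_mset y Y = add_mset (y + s) (replicate_mset (size Y) 0)"
    proof cases
      case 1
      then show ?thesis
        by (simp add: s_def)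
    next
      case 2
      then obtain m where "size Y = Suc m"
        by (metis size_eq_0_iff_empty not0_implies_Suc)
      then show ?thesis
        using 2 asm by auto
    qed
  next
    assume eq: "add_mset y Y = add_mset (y + s) (replicate_mset (size Y) 0)"
    show "a * (s + 2) = 2 * P \<and> (s = 0 \<or> y = 0)"
    proof (cases "s = 0")
      case True
      then have "Y = replicate_mset (size Y) 0"
        using eq by simp
      then have "Y = {#} \<or> Y = add_mset s (replicate_mset (size Y - 1) 0)"
        using True by (cases "size Y") auto
      then show ?thesis
        using IH(2) True by blast
    next
      case False
      \<comment> \<open>Since \<open>y + s\<close> differs from \<open>y\<close>, it must come from
        \<open>Y\<close>; then \<open>y\<close> can only be one of the zeros on the right.\<close>
      then have "y + s \<in># Y"
        using eq by (metis add_cancel_right_right insert_noteq_member multi_member_last)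
      moreover have "y \<in># add_mset (y + s) (replicate_mset (size Y) 0)"
        unfolding eq[symmetric] by simp
      ultimately have "y = 0"
        using False by (auto split: if_splits)
      obtain m where "size Y = Suc m"
        using \<open>y + s \<in># Y\<close> by (metis size_eq_Suc_imp_eq_union size_Suc_Diff1)
      then have "Y = add_mset s (replicate_mset (size Y - 1) 0)"
        using eq \<open>y = 0\<close> by (simp add: add_mset_commute)
      then show ?thesis
        using IH(2) \<open>y = 0\<close> by blast
    qed
  qed
  finally have "2 * a * (y + s + 2) = 2 * P * (y + 2) \<longleftrightarrow>
      add_mset y Y = add_mset (y + s) (replicate_mset (size Y) 0)" .
  moreover have "2 * a * (y + s + 2) \<le> 2 * P * (y + 2)"
    using expand le by linarith
  ultimately show ?case
    by (simp add: a_def s_def P_def algebra_simps)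
qed simp

text \<open>Multiplicities are integers as in \<open>has_degree_sequence\<close>: for empty
  \<open>Y\<close> there are -1 zeros, which cancel the leading \<open>t\<close> precisely when
  \<open>t = 0\<close>. This covers the single edge, where every vertex is pendant.\<close>

lemma count_eq_iff_add_mset_replicate:
  fixes Y :: "nat multiset"
  shows "(\<forall>d. int (count Y d) = (if d = t then 1 else 0) + (if d = 0 then int (size Y) - 1 else 0))
    \<longleftrightarrow> Y = {#} \<and> t = 0 \<or> Y = add_mset t (replicate_mset (size Y - 1) 0)"
proof (cases "size Y")
  case 0
  then show ?thesis
    by (auto split: if_splits)
next
  case (Suc m)
  have "(int (count Y d) = (if d = t then 1 else 0) + (if d = 0 then int (size Y) - 1 else 0))
      \<longleftrightarrow> count Y d = count (add_mset t (replicate_mset (size Y - 1) 0)) d" for d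
    using Suc by auto
  then have "(\<forall>d. int (count Y d) = (if d = t then 1 else 0) + (if d = 0 then int (size Y) - 1 else 0))
      \<longleftrightarrow> Y = add_mset t (replicate_mset (size Y - 1) 0)"
    by (simp only: multiset_eq_iff)
  moreover have "Y \<noteq> {#}"
    using Suc by auto
  ultimately show ?thesis
    by simp
qed

text \<open>Graphs supply only a lower bound \<open>t\<close> for the sum. Equality therefore splits
  into the sum attaining \<open>t\<close> and equality in the product inequality.\<close>

lemma prod_mset_add_two_bound:
  fixes Y :: "nat multiset"
  assumes "sum_mset Y \<ge> t"
  shows "2 ^ size Y * (t + 2) \<le> 2 * (\<Prod>y\<in>#Y. y + 2)"
    and "2 ^ size Y * (t + 2) = 2 * (\<Prod>y\<in>#Y. y + 2) \<longleftrightarrow>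
      (\<forall>d. int (count Y d) = (if d = t then 1 else 0) + (if d = 0 then int (size Y) - 1 else 0))"
proof -
  have le: "2 ^ size Y * (t + 2) \<le> 2 ^ size Y * (sum_mset Y + 2)"
    using assms by simp
  then show "2 ^ size Y * (t + 2) \<le> 2 * (\<Prod>y\<in>#Y. y + 2)"
    using prod_mset_add_two[of Y] by linarith
  have "2 ^ size Y * (t + 2) = 2 * (\<Prod>y\<in>#Y. y + 2) \<longleftrightarrow>
      2 ^ size Y * (t + 2) = 2 ^ size Y * (sum_mset Y + 2) \<and>
      2 ^ size Y * (sum_mset Y + 2) = 2 * (\<Prod>y\<in>#Y. y + 2)"
    using le prod_mset_add_two[of Y] by linarith
  also have "\<dots> \<longleftrightarrow> sum_mset Y = t \<and>
      (Y = {#} \<or> Y = add_mset (sum_mset Y) (replicate_mset (size Y - 1) 0))"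
    using prod_mset_add_two[of Y] by auto
  also have "\<dots> \<longleftrightarrow> Y = {#} \<and> t = 0 \<or> Y = add_mset t (replicate_mset (size Y - 1) 0)"
  proof -
    have "sum_mset Y = t" if "Y = add_mset t (replicate_mset (size Y - 1) 0)"
      using arg_cong[OF that, of sum_mset] by simp
    then show ?thesis
      by auto
  qed
  finally show "2 ^ size Y * (t + 2) = 2 * (\<Prod>y\<in>#Y. y + 2) \<longleftrightarrow>
      (\<forall>d. int (count Y d) = (if d = t then 1 else 0) + (if d = 0 then int (size Y) - 1 else 0))"
    by (simp only: count_eq_iff_add_mset_replicate)
qed

section \<open>From degree excesses to the Zagreb index\<close>

text \<open>Treats all cases at once: \<open>m\<close> is the leading degree of the extremal
  sequence, taken as 2, 3 and \<open>k\<close> for \<open>k = 0\<close>, \<open>k = 1\<close> and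
  \<open>k \<ge> 2\<close>. The arc hypothesis says that the excesses over 2 of the non-pendant
  degrees sum to at least \<open>m - 2\<close>.\<close>

lemma (in graph) mult_Zagreb1_bound:
  assumes "c > 0"
    and isolated: "\<And>v. v \<in> verts G \<Longrightarrow> out_degree G v \<noteq> 0"
    and n: "card (verts G) = n" and k: "card (pendant_verts G) = k"
    and m: "m \<ge> 2" "2 * n + m \<le> card (arcs G) + k + 2"
  defines "B \<equiv> 2 powr (real n - real k - 1) * real m"
  shows "B powr c \<le> mult_Zagreb1 c G"
    and "mult_Zagreb1 c G = B powr c \<longleftrightarrow>
      has_degree_sequence G [(m, 1), (2, int n - int k - 1), (1, int k)]"
proof -
  define t where "t = m - 2"
  have t: "m = t + 2"
    using m by (simp add: t_def)
  define N where "N = verts G - pendant_verts G"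
  \<comment> \<open>The truncated subtraction is exact: a vertex neither isolated nor pendant has
    degree at least 2.\<close>
  define Y where "Y = image_mset (\<lambda>v. out_degree G v - 2) (mset_set N)"
  have pend: "pendant_verts G \<subseteq> verts G"
    by (auto simp: pendant_verts_def)
  have fin: "finite N" "finite (pendant_verts G)"
    using pend finite_subset[OF pend] by (auto simp: N_def)
  have deg: "out_degree G v \<ge> 2" if "v \<in> N" for v
    using that isolated[of v] by (auto simp: N_def pendant_verts_def)
  then have deg_eq: "out_degree G v = (out_degree G v - 2) + 2" if "v \<in> N" for v
    using that by fastforce
  have "k \<le> n"
    using card_mono[OF finite_verts pend] n k by simp
  have size: "size Y = n - k"
    using pend fin n k by (simp add: Y_def N_def card_Diff_subset)
  have split: "verts G = N \<union> pendant_verts G" "N \<inter> pendant_verts G = {}"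
    using pend by (auto simp: N_def)
  have pend_sum: "(\<Sum>v\<in>pendant_verts G. out_degree G v) = k"
    and pend_prod: "(\<Prod>v\<in>pendant_verts G. out_degree G v) = 1"
    using k by (simp_all add: pendant_verts_def)
  have "(\<Sum>v\<in>verts G. out_degree G v) = (\<Sum>v\<in>N. out_degree G v) + k"
    by (simp add: split(1) sum.union_disjoint[OF fin split(2)] pend_sum)
  also have "(\<Sum>v\<in>N. out_degree G v) = (\<Sum>v\<in>N. (out_degree G v - 2) + 2)"
    by (rule sum.cong[OF refl]) (rule deg_eq)
  also have "\<dots> = sum_mset Y + 2 * size Y"
    unfolding sum.distrib by (simp add: Y_def sum_unfold_sum_mset)
  \<comment> \<open>The degree sum is the arc count, so \<open>sum_mset Y\<close> equals
    \<open>card (arcs G) + k - 2 * n\<close>.\<close>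
  finally have "t \<le> sum_mset Y"
    using m(2) t size sum_out_degree \<open>k \<le> n\<close> by linarith
  note bound = prod_mset_add_two_bound[OF this]
  define P where "P = (\<Prod>v\<in>verts G. out_degree G v)"
  have "P = (\<Prod>v\<in>N. out_degree G v)"
    by (simp add: P_def split(1) prod.union_disjoint[OF fin split(2)] pend_prod)
  also have "\<dots> = (\<Prod>v\<in>N. (out_degree G v - 2) + 2)"
    by (rule prod.cong[OF refl]) (rule deg_eq)
  finally have P: "P = (\<Prod>y\<in>#Y. y + 2)"
    by (simp only: Y_def prod_unfold_prod_mset image_mset.compositionality comp_def)
  have Z: "mult_Zagreb1 c G = real P powr c"
    by (simp add: mult_Zagreb1_def P_def prod_powr_distrib)
  \<comment> \<open>Doubling replaces the exponent \<open>n - k - 1\<close>, which is -1 when all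
    vertices are pendant, by the natural number \<open>n - k\<close>.\<close>
  have B: "2 * B = real (2 ^ (n - k) * (t + 2))"
  proof -
    have "2 powr (real n - real k - 1) = 2 powr real (n - k) / 2"
      using \<open>k \<le> n\<close> by (simp add: powr_diff of_nat_diff)
    then show ?thesis
      unfolding B_def t by (simp only: of_nat_mult of_nat_power of_nat_numeral powr_realpow)
  qed
  have "2 ^ (n - k) * (t + 2) \<le> 2 * P"
    using bound(1) by (simp add: P size)
  then have "real (2 ^ (n - k) * (t + 2)) \<le> real (2 * P)"
    by (rule of_nat_mono)
  then have BP: "B \<le> real P"
    using B by simp
  have "B \<ge> 0"
    by (simp add: B_def)
  then show "B powr c \<le> mult_Zagreb1 c G"
    using \<open>c > 0\<close> BP by (simp add: Z powr_mono2)
  have degree_mset: "degree_mset G = image_mset (\<lambda>y. y + 2) Y + replicate_mset k 1"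
  proof -
    have "degree_mset G = image_mset (out_degree G) (mset_set N)
        + image_mset (out_degree G) (mset_set (pendant_verts G))"
      by (simp add: degree_mset_def split(1) mset_set_Union[OF fin split(2)])
    also have "image_mset (out_degree G) (mset_set N) = image_mset (\<lambda>y. y + 2) Y"
      unfolding Y_def image_mset.compositionality comp_def
      using deg_eq fin by (intro image_mset_cong) simp
    also have "image_mset (out_degree G) (mset_set (pendant_verts G))
        = image_mset (\<lambda>_. 1) (mset_set (pendant_verts G))"
      using fin by (intro image_mset_cong) (auto simp: pendant_verts_def)
    finally show ?thesis
      using k by (simp add: image_mset_const_eq)
  qed
  have count: "count (degree_mset G) d =
      (if d \<ge> 2 then count Y (d - 2) else if d = 1 then k else 0)" for d
  proof -
    have shift: "count (image_mset (\<lambda>y. y + 2) Y) (y + 2) = count Y y" for y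
      by (induction Y) auto
    show ?thesis
    proof (cases "d \<ge> 2")
      case True
      then obtain y where "d = y + 2"
        by (metis add.commute le_Suc_ex)
      then show ?thesis
        by (simp only: degree_mset count_union shift) simp
    next
      case False
      then have "count (image_mset (\<lambda>y. y + 2) Y) d = 0"
        by (intro not_in_iff[THEN iffD1]) auto
      then show ?thesis
        using False by (auto simp: degree_mset)
    qed
  qed
  \<comment> \<open>As \<open>B\<close> is at most \<open>P\<close>, strict monotonicity of
    \<open>powr\<close> in the base removes the exponent \<open>c\<close>.\<close>
  have "mult_Zagreb1 c G = B powr c \<longleftrightarrow> real P = B"
    using powr_less_mono2[OF \<open>c > 0\<close> \<open>B \<ge> 0\<close>, of "real P"] BP by (force simp: Z)
  also have "\<dots> \<longleftrightarrow> 2 ^ (n - k) * (t + 2) = 2 * P"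
  proof -
    have "real P = B \<longleftrightarrow> real (2 ^ (n - k) * (t + 2)) = real (2 * P)"
      using B by auto
    then show ?thesis
      by (simp only: of_nat_eq_iff)
  qed
  also have "\<dots> \<longleftrightarrow> (\<forall>d. int (count Y d) =
      (if d = t then 1 else 0) + (if d = 0 then int (size Y) - 1 else 0))"
    using bound(2) by (simp only: P size)
  \<comment> \<open>Excess \<open>d\<close> corresponds to degree \<open>d + 2\<close>:
    \<open>t\<close> becomes \<open>m\<close>, 0 becomes 2, and \<open>size Y - 1\<close> is
    \<open>n - k - 1\<close>.\<close>
  also have "\<dots> \<longleftrightarrow> has_degree_sequence G [(m, 1), (2, int n - int k - 1), (1, int k)]"
  proof
    assume L: "\<forall>d. int (count Y d) =
      (if d = t then 1 else 0) + (if d = 0 then int (size Y) - 1 else 0)"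
    show "has_degree_sequence G [(m, 1), (2, int n - int k - 1), (1, int k)]"
      unfolding has_degree_sequence_def
    proof
      fix d
      show "int (count (degree_mset G) d)
          = (\<Sum>(e, l)\<leftarrow>[(m, 1), (2, int n - int k - 1), (1, int k)]. if e = d then l else 0)"
        using L[rule_format, of "d - 2"] size \<open>k \<le> n\<close> by (auto simp: t count)
    qed
  next
    assume R: "has_degree_sequence G [(m, 1), (2, int n - int k - 1), (1, int k)]"
    show "\<forall>d. int (count Y d) =
      (if d = t then 1 else 0) + (if d = 0 then int (size Y) - 1 else 0)"
    proof
      fix d
      show "int (count Y d) =
          (if d = t then 1 else 0) + (if d = 0 then int (size Y) - 1 else 0)"
        using R[unfolded has_degree_sequence_def, rule_format, of "d + 2"] size \<open>k \<le> n\<close>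
        by (auto simp: t count)
    qed
  qed
  finally show "mult_Zagreb1 c G = B powr c \<longleftrightarrow>
      has_degree_sequence G [(m, 1), (2, int n - int k - 1), (1, int k)]" .
qed

section \<open>Cases by the number of pendant vertices\<close>

theorem theorem1:
  fixes c :: real and n k :: nat and G :: "('a, 'b) pre_digraph"
  assumes "c > 0" and "n \<ge> k" and "G \<in> cacti n k"
  shows "(k \<in> {0, 1} \<longrightarrow>
            mult_Zagreb1 c G \<ge> 3 powr (real k * c) * 2 powr ((real n - 2 * real k) * c) \<and>
            (mult_Zagreb1 c G = 3 powr (real k * c) * 2 powr ((real n - 2 * real k) * c) \<longleftrightarrow>
              has_degree_sequence G [(3, int k), (2, int n - 2 * int k), (1, int k)])) \<and>
         (k \<ge> 2 \<longrightarrow>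
            mult_Zagreb1 c G \<ge> 2 powr ((real n - real k - 1) * c) * real k powr c \<and>
            (mult_Zagreb1 c G = 2 powr ((real n - real k - 1) * c) * real k powr c \<longleftrightarrow>
              has_degree_sequence G [(k, 1), (2, int n - int k - 1), (1, int k)]))"
proof -
  have cactus: "cactus G" and n: "card (verts G) = n" and k: "card (pendant_verts G) = k"
    using assms(3) by (auto simp: cacti_def)
  interpret graph G
    using cactus by (simp add: cactus_def)
  have conn: "connected G"
    using cactus by (simp add: cactus_def)
  have isolated: "out_degree G v \<noteq> 0" if "v \<in> verts G" for v
    using strongly_connected_out_arcs[OF symmetric_connected_imp_strongly_connected[OF sym_arcs conn] that]
      cactus_not_single_vertex[OF cactus] finite_out_arcs[of v]
    by (simp add: out_degree_def)
  have arcs: "2 * n \<le> card (arcs G) + 2"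
    using connected_card_arcs[OF conn] n by simp
  \<comment> \<open>Adding 1 at each pendant vertex lifts every degree to at least 2. For
    \<open>k \<le> 1\<close> this is stronger than the bound \<open>arcs\<close> from
    connectedness.\<close>
  have degree_sum: "2 * n \<le> card (arcs G) + k"
  proof -
    have "(\<Sum>v\<in>verts G. 2) \<le> (\<Sum>v\<in>verts G. out_degree G v + (if v \<in> pendant_verts G then 1 else 0))"
    proof (rule sum_mono)
      fix v assume "v \<in> verts G"
      then show "2 \<le> out_degree G v + (if v \<in> pendant_verts G then 1 else 0)"
        using isolated[of v] by (auto simp: pendant_verts_def)
    qed
    also have "\<dots> = card (arcs G) + card (verts G \<inter> pendant_verts G)"
      by (simp add: sum.distrib sum_out_degree sum.If_cases)
    also have "verts G \<inter> pendant_verts G = pendant_verts G"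
      by (auto simp: pendant_verts_def)
    finally show ?thesis
      using n k by simp
  qed
  note bound = mult_Zagreb1_bound[OF assms(1) isolated n k]
  consider "k = 0" | "k = 1" | "k \<ge> 2"
    by linarith
  then show ?thesis
  proof cases
    case 1
    \<comment> \<open>With \<open>m = 2\<close> the leading term merges with the
      \<open>n - 1\<close> other twos.\<close>
    have "(2 powr (real n - real k - 1) * real 2) powr c = 2 powr (real n * c)"
      using 1 by (simp add: powr_diff powr_powr)
    moreover have "has_degree_sequence G [(2, 1), (2, int n - int k - 1), (1, int k)] \<longleftrightarrow>
        has_degree_sequence G [(3, int k), (2, int n - 2 * int k), (1, int k)]"
      using 1 by (auto simp: has_degree_sequence_def)
    ultimately show ?thesis
      using bound[of 2] degree_sum 1 by simp
  next
    case 2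
    have "2 * n + 3 \<le> card (arcs G) + k + 2"
      using degree_sum even_card_arcs 2 by presburger
    moreover have "(2 powr (real n - real k - 1) * real 3) powr c
        = 3 powr (real k * c) * 2 powr ((real n - 2 * real k) * c)"
      using 2 by (simp add: powr_mult powr_powr)
    moreover have "has_degree_sequence G [(3, 1), (2, int n - int k - 1), (1, int k)] \<longleftrightarrow>
        has_degree_sequence G [(3, int k), (2, int n - 2 * int k), (1, int k)]"
      using 2 by simp
    ultimately show ?thesis
      using bound[of 3] 2 by simp
  next
    case 3
    \<comment> \<open>With \<open>m = k\<close> the arc hypothesis is the edge bound for connected
      graphs with \<open>k\<close> added on both sides.\<close>
    have "2 * n + k \<le> card (arcs G) + k + 2"
      using arcs by simp
    moreover have "(2 powr (real n - real k - 1) * real k) powr c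
        = 2 powr ((real n - real k - 1) * c) * real k powr c"
      by (simp add: powr_mult powr_powr)
    ultimately show ?thesis
      using bound[of k] 3 by simp
  qed
qed

end
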